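(* Let $n\ge 3$ and let $K$ be an $n$-gon, viewed as a simplicial complex with $n$ vertices $v_0,\dots,v_{n-1}$ and $n$ edges, the edge set being $E=\{[v_i,v_{i+1}]\mid 0\le i\le n-1\}$ where $v_n:=v_0$. Let $\alpha_0,\dots,\alpha_{n-1}\in\mathbb{Z}$. Let the weight function $\phi:K\times K\to\mathbb{Z}$ be such that $\phi([v_i,v_j],[v_i])=\alpha_i$ and $\phi([v_i,v_j],[v_j])=\alpha_j$ for every edge $[v_i,v_j]$ of $K$ with $i<j$. Let $d_1,d_2,\dots,d_n\ge 0$ be the diagonal entries of the Smith normal form (so $d_k\mid d_{k+1}$) of the $n\times n$ integer matrix $[\partial_1]$ of the $\phi$-weighted boundary map $\partial_1:C_1(K;\mathbb{Z})\to C_0(K;\mathbb{Z})$. Then $$H_0(K,\phi;\mathbb{Z})\cong\mathbb{Z}/d_1\oplus\dots\oplus\mathbb{Z}/d_{n-1}\oplus\mathbb{Z},$$ where $$d_1d_2\cdots d_k=\gcd\left(\{\alpha_{i_1}\alpha_{i_2}\cdots\alpha_{i_k}\mid 0\le i_1<i_2<\dots<i_k\le n-1\}\right)$$ for $1\le k\le n-1$, and $d_n=0$.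
   Context: The vertices are ordered $v_0<v_1<\dots<v_{n-1}$, and each edge is positively oriented when written with its vertices in ascending order; thus the edge joining $v_{n-1}$ and $v_0$ is $[v_0,v_{n-1}]$. The $\phi$-weighted boundary map $\partial_1:C_1(K;\mathbb{Z})\to C_0(K;\mathbb{Z})$ is the $\mathbb{Z}$-linear map with $\partial_1([v_i,v_j])=\phi([v_i,v_j],[v_j])\,[v_j]-\phi([v_i,v_j],[v_i])\,[v_i]$ for every edge $[v_i,v_j]$, $i<j$, and $\partial_0=0$. Here $C_m(K;\mathbb{Z})$ is the free abelian group on the $m$-simplices of $K$, and $H_0(K,\phi;\mathbb{Z})=\ker\partial_0/\operatorname{Im}\partial_1=C_0(K;\mathbb{Z})/\operatorname{Im}\partial_1$. The matrix $[\partial_1]$ is taken with respect to the bases of edges and vertices. Values of $\phi$ on pairs $(\sigma,\tau)$ where $\tau$ is not a face of $\sigma$, or where $\sigma$ is a vertex, are irrelevant (set to $0$ by convention). $\mathbb{Z}/d$ denotes $\mathbb{Z}/d\mathbb{Z}$, with $\mathbb{Z}/0=\mathbb{Z}$, and $\gcd$ of a set of zeros is $0$. *)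

theory Defs
  imports "HOL-Algebra.Free_Abelian_Groups" "HOL-Algebra.Product_Groups"
    "HOL-Algebra.Elementary_Groups" "Jordan_Normal_Form.Matrix"
begin

(* Simplices are represented by their vertex sets; the orientation of a simplex
   comes from the linear order on the vertex type. *)

definition ngon :: "nat \<Rightarrow> (nat \<Rightarrow> 'a) \<Rightarrow> 'a set set" where
  "ngon n v = {{v i} |i. i < n} \<union> {{v i, v (Suc i mod n)} |i. i < n}"

definition simplices :: "'a set set \<Rightarrow> nat \<Rightarrow> 'a set set" where
  "simplices K m = {\<sigma> \<in> K. card \<sigma> = Suc m}"

definition chain_grp :: "'a set set \<Rightarrow> nat \<Rightarrow> ('a set \<Rightarrow>\<^sub>0 int) monoid" where
  "chain_grp K m = free_Abelian_group (simplices K m)"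

(* The weighted boundary on 1-chains: an edge [u,w] with u < w has Min = u and Max = w. *)
definition weighted_boundary1 ::
  "('a::linorder set \<Rightarrow> 'a set \<Rightarrow> int) \<Rightarrow> ('a set \<Rightarrow>\<^sub>0 int) \<Rightarrow> ('a set \<Rightarrow>\<^sub>0 int)" where
  "weighted_boundary1 \<phi> = frag_extend (\<lambda>\<sigma>.
      frag_cmul (\<phi> \<sigma> {Max \<sigma>}) (frag_of {Max \<sigma>}) -
      frag_cmul (\<phi> \<sigma> {Min \<sigma>}) (frag_of {Min \<sigma>}))"

(* The boundary map on 0-chains is zero, so its kernel is the whole group of 0-chains. *)
definition weighted_H0 ::
  "'a::linorder set set \<Rightarrow> ('a set \<Rightarrow> 'a set \<Rightarrow> int) \<Rightarrow> ('a set \<Rightarrow>\<^sub>0 int) set monoid" where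
  "weighted_H0 K \<phi> =
     chain_grp K 0 Mod (weighted_boundary1 \<phi> ` carrier (chain_grp K 1))"

(* Column j holds the coordinates, with respect to the basis ys, of the image of
   the j-th element of the basis xs. *)
definition matrix_wrt ::
  "(('a \<Rightarrow>\<^sub>0 int) \<Rightarrow> ('b \<Rightarrow>\<^sub>0 int)) \<Rightarrow> 'a list \<Rightarrow> 'b list \<Rightarrow> int mat" where
  "matrix_wrt f xs ys =
     mat (length ys) (length xs) (\<lambda>(i, j). Poly_Mapping.lookup (f (frag_of (xs ! j))) (ys ! i))"

definition ngon_boundary_matrix ::
  "nat \<Rightarrow> (nat \<Rightarrow> 'a::linorder) \<Rightarrow> ('a set \<Rightarrow> 'a set \<Rightarrow> int) \<Rightarrow> int mat" where
  "ngon_boundary_matrix n v \<phi> =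
     matrix_wrt (weighted_boundary1 \<phi>)
       (map (\<lambda>i. {v i, v (Suc i mod n)}) [0..<n]) (map (\<lambda>i. {v i}) [0..<n])"

definition is_smith_normal_form :: "int mat \<Rightarrow> int mat \<Rightarrow> bool" where
  "is_smith_normal_form A S \<longleftrightarrow>
     (\<exists>P Q. P \<in> carrier_mat (dim_row A) (dim_row A) \<and> invertible_mat P \<and>
            Q \<in> carrier_mat (dim_col A) (dim_col A) \<and> invertible_mat Q \<and>
            S = P * A * Q) \<and>
     diagonal_mat S \<and>
     (\<forall>i < min (dim_row S) (dim_col S). 0 \<le> S $$ (i, i)) \<and>
     (\<forall>i. Suc i < min (dim_row S) (dim_col S) \<longrightarrow> S $$ (i, i) dvd S $$ (Suc i, Suc i))"

end

theory Submission
  imports Defs "Jordan_Normal_Form.Determinant"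
begin

text \<open>
  In the bases of vertices and edges, row \<open>i\<close> of the weighted boundary matrix is \<open>\<alpha> i\<close> times row
  \<open>i\<close> of the incidence matrix of an oriented cycle.  So the matrix factors as a diagonal matrix
  times the cycle incidence matrix (\<open>ngon_boundary_matrix_eq\<close>), and the rest is about integer
  matrices.

  The products \<open>d 1 \<cdots> d k\<close> are the gcds of the \<open>k\<close>-minors.  Instead of minors, the proof uses the
  larger set of all determinants \<open>det (X A Y)\<close> with \<open>X\<close> of size \<open>k \<times> n\<close> and \<open>Y\<close> of size \<open>n \<times> k\<close>.
  By the Cauchy-Binet formula these are integer combinations of minors, so the gcd is the same,
  but the set is visibly unchanged when \<open>A\<close> is multiplied by invertible matrices on either side.
  For a matrix \<open>D N\<close> with \<open>D\<close> diagonal, multilinearity of the determinant in the rows shows that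
  every \<open>det (X D N Y)\<close> is a combination of products of \<open>k\<close> diagonal entries of \<open>D\<close>
  (\<open>dvd_det_mult_diag_mult\<close>).  Conversely, the product over \<open>I\<close> occurs in the set as soon as \<open>Y\<close>
  can be chosen so that the rows of \<open>N Y\<close> in \<open>I\<close> form an identity matrix.  For the Smith normal
  form, \<open>N = 1\<close> and this is obvious, and the divisibility chain makes the product of the first
  \<open>k\<close> entries the gcd.  For the cycle, the differences of two unit vectors lie in the column
  space, so subtracting a unit vector with index outside \<open>I\<close> provides \<open>Y\<close> whenever \<open>k < n\<close>
  (\<open>cycle_incidence_unit_columns\<close>).  For \<open>k = n\<close> the incidence matrix is singular, which forces
  \<open>d n = 0\<close>.

  For the homology group, the left transformation \<open>P\<close> of the Smith normal form carries the image
  of the boundary map to the vectors whose coordinate \<open>k\<close> is divisible by \<open>d k\<close>.  Reducing the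
  coordinates of \<open>P c\<close> modulo the \<open>d k\<close> is therefore a surjection with kernel the boundaries
  (\<open>free_Abelian_group_Mod_image_iso\<close>), and its last component is the free summand as \<open>d n = 0\<close>.
\<close>

section \<open>Determinants of compressions of a diagonal multiple\<close>

text \<open>The minors are the members for which \<open>X\<close> selects rows and \<open>Y\<close> selects columns; allowing all
  \<open>X\<close> and \<open>Y\<close> makes the set invariant under unimodular equivalence with no computation.\<close>

definition compressed_minors :: "nat \<Rightarrow> 'a::comm_ring_1 mat \<Rightarrow> 'a set" where
  "compressed_minors k A =
     {det (X * A * Y) | X Y. X \<in> carrier_mat k (dim_row A) \<and> Y \<in> carrier_mat (dim_col A) k}"

definition diag_of :: "nat \<Rightarrow> (nat \<Rightarrow> 'a::zero) \<Rightarrow> 'a mat" where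
  "diag_of n \<alpha> = mat n n (\<lambda>(i, j). if i = j then \<alpha> i else 0)"

lemma diag_of_carrier [simp]: "diag_of n \<alpha> \<in> carrier_mat n n"
  by (simp add: diag_of_def)

lemma diag_of_dim [simp]: "dim_row (diag_of n \<alpha>) = n" "dim_col (diag_of n \<alpha>) = n"
  by (simp_all add: diag_of_def)

lemma index_diag_of_mult:
  fixes B :: "'a::semiring_1 mat"
  assumes "B \<in> carrier_mat n m" "i < n" "j < m"
  shows "(diag_of n \<alpha> * B) $$ (i, j) = \<alpha> i * B $$ (i, j)"
proof -
  have "(diag_of n \<alpha> * B) $$ (i, j) = (\<Sum>l<n. (if i = l then \<alpha> i else 0) * B $$ (l, j))"
    using assms by (simp add: scalar_prod_def diag_of_def atLeast0LessThan)
  also have "\<dots> = (\<Sum>l<n. if i = l then \<alpha> i * B $$ (i, j) else 0)"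
    by (intro sum.cong) auto
  finally show ?thesis
    using assms by simp
qed

lemma index_mult_diag_of:
  fixes B :: "'a::semiring_1 mat"
  assumes "B \<in> carrier_mat m n" "i < m" "j < n"
  shows "(B * diag_of n \<alpha>) $$ (i, j) = B $$ (i, j) * \<alpha> j"
proof -
  have "(B * diag_of n \<alpha>) $$ (i, j) = (\<Sum>l<n. B $$ (i, l) * (if l = j then \<alpha> l else 0))"
    using assms by (simp add: scalar_prod_def diag_of_def atLeast0LessThan)
  also have "\<dots> = (\<Sum>l<n. if l = j then B $$ (i, j) * \<alpha> j else 0)"
    by (intro sum.cong) auto
  finally show ?thesis
    using assms by simp
qed

text \<open>This is the half of the Cauchy-Binet formula that is needed.  Each row of \<open>X D Z\<close> is a
  combination of rows of \<open>Z\<close>; expanding the determinant in all rows gives one term for every map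
  \<open>f\<close> from row positions to rows of \<open>Z\<close>.  A repeated row kills the term, and an injective \<open>f\<close>
  contributes the product of the diagonal entries over its range.\<close>

lemma dvd_det_mult_diag_mult:
  fixes X Z :: "'a::comm_ring_1 mat"
  assumes X: "X \<in> carrier_mat k n" and Z: "Z \<in> carrier_mat n k"
    and g: "\<And>I. I \<subseteq> {..<n} \<Longrightarrow> card I = k \<Longrightarrow> g dvd (\<Prod>i\<in>I. \<alpha> i)"
  shows "g dvd det (X * diag_of n \<alpha> * Z)"
proof -
  let ?F = "{f. (\<forall>i\<in>{0..<k}. f i \<in> {0..<n}) \<and> (\<forall>i. i \<notin> {0..<k} \<longrightarrow> f i = i)}"
  let ?c = "\<lambda>f i. (X * diag_of n \<alpha>) $$ (i, f i)"
  have rows: "X * diag_of n \<alpha> * Z =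
      mat\<^sub>r k k (\<lambda>i. finsum_vec TYPE('a) k (\<lambda>l. (X * diag_of n \<alpha>) $$ (i, l) \<cdot>\<^sub>v row Z l) {0..<n})"
    by (rule mat_mul_finsum_alt) (use X Z in auto)
  have det_eq: "det (X * diag_of n \<alpha> * Z) =
      (\<Sum>f\<in>?F. det (mat\<^sub>r k k (\<lambda>i. ?c f i \<cdot>\<^sub>v row Z (f i))))"
    unfolding rows
  proof (rule det_linear_rows_sum)
    show "(\<lambda>i l. (X * diag_of n \<alpha>) $$ (i, l) \<cdot>\<^sub>v row Z l) \<in> {0..<k} \<rightarrow> {0..<n} \<rightarrow> carrier_vec k"
      using Z by (intro Pi_I smult_carrier_vec row_carrier_vec) auto
  qed simp
  have "g dvd det (mat\<^sub>r k k (\<lambda>i. ?c f i \<cdot>\<^sub>v row Z (f i)))" if f: "f \<in> ?F" for f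
  proof -
    let ?R = "mat\<^sub>r k k (\<lambda>i. row Z (f i))"
    \<comment> \<open>the coefficients come out, leaving the minor of \<open>Z\<close> with rows picked by \<open>f\<close>\<close>
    have split: "det (mat\<^sub>r k k (\<lambda>i. ?c f i \<cdot>\<^sub>v row Z (f i))) = prod (?c f) {0..<k} * det ?R"
      by (rule det_rows_mul) (use Z in auto)
    show ?thesis
    proof (cases "inj_on f {0..<k}")
      case True
      have "prod (?c f) {0..<k} = (\<Prod>i\<in>{0..<k}. X $$ (i, f i) * \<alpha> (f i))"
        by (rule prod.cong) (use f in \<open>auto simp: index_mult_diag_of[OF X] simp del: index_mult_mat(1)\<close>)
      also have "\<dots> = (\<Prod>i\<in>{0..<k}. X $$ (i, f i)) * (\<Prod>i\<in>f ` {0..<k}. \<alpha> i)"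
        using True by (simp add: prod.distrib prod.reindex)
      finally show ?thesis
        unfolding split using f g[of "f ` {0..<k}"] True
        by (simp add: card_image image_subset_iff)
    next
      case False
      then obtain i j where ij: "f i = f j" "i \<noteq> j" "i < k" "j < k"
        unfolding inj_on_def by auto
      have "det ?R = 0"
        by (rule det_identical_rows[OF _ ij(2-4)]) (use ij Z f in auto)
      then show ?thesis
        unfolding split by simp
    qed
  qed
  then show ?thesis
    unfolding det_eq by (rule dvd_sum)
qed

lemma det_diag_of: "det (diag_of n \<alpha>) = (\<Prod>i<n. \<alpha> i)" for \<alpha> :: "nat \<Rightarrow> 'a::comm_ring_1"
  by (subst det_upper_triangular[of _ n])
    (auto simp: diag_of_def prod_list_diag_prod atLeast0LessThan)

text \<open>Selecting the rows \<open>xs\<close> turns \<open>D N Y\<close> into a diagonal matrix, with the entries of \<open>\<alpha>\<close> at \<open>xs\<close>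
  on the diagonal, because \<open>N Y\<close> is an identity matrix there.\<close>

lemma prod_mem_compressed_minors:
  fixes N :: "'a::comm_ring_1 mat"
  assumes N: "N \<in> carrier_mat n m" and Y: "Y \<in> carrier_mat m (length xs)"
    and xs: "distinct xs" "set xs \<subseteq> {..<n}"
    and NY: "\<And>i j. i < length xs \<Longrightarrow> j < length xs \<Longrightarrow>
               (N * Y) $$ (xs ! i, j) = (if i = j then 1 else 0)"
  shows "(\<Prod>i\<in>set xs. \<alpha> i) \<in> compressed_minors (length xs) (diag_of n \<alpha> * N)"
proof -
  define k where "k = length xs"
  define X :: "'a mat" where "X = mat k n (\<lambda>(i, l). if l = xs ! i then 1 else 0)"
  have X: "X \<in> carrier_mat k n"
    by (simp add: X_def)
  have Y': "Y \<in> carrier_mat m k"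
    using Y by (simp add: k_def)
  have in_range: "xs ! i < n" if "i < k" for i
    using that subsetD[OF xs(2) nth_mem[of i xs]] by (simp add: k_def)
  have "X * (diag_of n \<alpha> * N) * Y = X * (diag_of n \<alpha> * (N * Y))"
    using assoc_mult_mat[OF X mult_carrier_mat[OF diag_of_carrier N] Y']
      assoc_mult_mat[OF diag_of_carrier N Y'] by simp
  also have "\<dots> = diag_of k (\<lambda>i. \<alpha> (xs ! i))"
  proof (rule eq_matI)
    fix i j assume ij: "i < dim_row (diag_of k (\<lambda>i. \<alpha> (xs ! i)))"
      "j < dim_col (diag_of k (\<lambda>i. \<alpha> (xs ! i)))"
    have B: "diag_of n \<alpha> * (N * Y) \<in> carrier_mat n k" "N * Y \<in> carrier_mat n k"
      using N Y' by auto
    have "(X * (diag_of n \<alpha> * (N * Y))) $$ (i, j) =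
        (\<Sum>l<n. (if l = xs ! i then 1 else 0) * (diag_of n \<alpha> * (N * Y)) $$ (l, j))"
      using ij X carrier_matD[OF B(1)] by (simp add: scalar_prod_def X_def atLeast0LessThan del: index_mult_mat(1))
        (use ij X in \<open>simp add: index_mult_mat(1) scalar_prod_def atLeast0LessThan\<close>)
    also have "\<dots> = (\<Sum>l<n. if l = xs ! i then (diag_of n \<alpha> * (N * Y)) $$ (xs ! i, j) else 0)"
      by (intro sum.cong) auto
    also have "\<dots> = \<alpha> (xs ! i) * (N * Y) $$ (xs ! i, j)"
      using in_range ij B(2) by (simp add: index_diag_of_mult)
    finally show "(X * (diag_of n \<alpha> * (N * Y))) $$ (i, j) = diag_of k (\<lambda>i. \<alpha> (xs ! i)) $$ (i, j)"
      using ij NY[of i j] by (simp add: diag_of_def k_def)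
  qed (use X Y' N in auto)
  finally have "det (X * (diag_of n \<alpha> * N) * Y) = (\<Prod>i<k. \<alpha> (xs ! i))"
    by (simp add: det_diag_of)
  also have "\<dots> = (\<Prod>i\<in>set xs. \<alpha> i)"
    using xs(1) by (intro prod.reindex_bij_betw bij_betw_nth) (auto simp: k_def)
  finally show ?thesis
    using X Y N unfolding compressed_minors_def k_def
    by (intro CollectI exI[of _ X] exI[of _ Y]) auto
qed

text \<open>The hypothesis says that any \<open>k\<close> rows of \<open>N\<close> have a right inverse, so that every product of \<open>k\<close>
  diagonal entries is itself among the determinants; \<open>dvd_det_mult_diag_mult\<close> bounds them
  from the other side.\<close>

lemma Gcd_compressed_minors_diag_mult:
  fixes N :: "int mat"
  assumes N: "N \<in> carrier_mat n m"
    and Y: "\<And>xs. distinct xs \<Longrightarrow> set xs \<subseteq> {..<n} \<Longrightarrow> length xs = k \<Longrightarrow>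
      \<exists>Y \<in> carrier_mat m k. \<forall>i<k. \<forall>j<k. (N * Y) $$ (xs ! i, j) = (if i = j then 1 else 0)"
  shows "Gcd (compressed_minors k (diag_of n \<alpha> * N)) =
           Gcd {\<Prod>i\<in>I. \<alpha> i |I. I \<subseteq> {..<n} \<and> card I = k}" (is "?L = ?R")
proof (rule zdvd_antisym_nonneg)
  show "?L dvd ?R"
  proof (rule Gcd_greatest, clarsimp)
    fix I assume I: "I \<subseteq> {..<n}" "k = card I"
    define xs where "xs = sorted_list_of_set I"
    have xs: "distinct xs" "set xs = I" "length xs = k"
      using I finite_subset[OF I(1)] by (auto simp: xs_def)
    have range: "set xs \<subseteq> {..<n}"
      using I xs(2) by simp
    obtain Y where Y: "Y \<in> carrier_mat m k"
      "\<forall>i<k. \<forall>j<k. (N * Y) $$ (xs ! i, j) = (if i = j then 1 else 0)"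
      using Y[OF xs(1) range xs(3)] by blast
    have "Y \<in> carrier_mat m (length xs)"
      using Y(1) xs(3) by simp
    moreover have "(N * Y) $$ (xs ! i, j) = (if i = j then 1 else 0)"
      if "i < length xs" "j < length xs" for i j
      using Y(2)[rule_format, of i j] that unfolding xs(3) .
    ultimately have "(\<Prod>i\<in>set xs. \<alpha> i) \<in> compressed_minors (length xs) (diag_of n \<alpha> * N)"
      by (rule prod_mem_compressed_minors[OF N _ xs(1) range])
    then show "Gcd (compressed_minors (card I) (diag_of n \<alpha> * N)) dvd (\<Prod>i\<in>I. \<alpha> i)"
      unfolding xs(2,3) I(2)[symmetric] by (rule Gcd_dvd)
  qed
next
  show "?R dvd ?L"
  proof (rule Gcd_greatest)
    fix x assume "x \<in> compressed_minors k (diag_of n \<alpha> * N)"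
    then obtain X Y where x: "x = det (X * (diag_of n \<alpha> * N) * Y)"
      and XY: "X \<in> carrier_mat k n" "Y \<in> carrier_mat m k"
      using N by (auto simp: compressed_minors_def)
    have "X * (diag_of n \<alpha> * N) * Y = X * diag_of n \<alpha> * (N * Y)"
      using XY N assoc_mult_mat[of X k n "diag_of n \<alpha>" n N m]
        assoc_mult_mat[of "X * diag_of n \<alpha>" k n N m Y k] by auto
    moreover have "?R dvd det (X * diag_of n \<alpha> * (N * Y))"
    proof (rule dvd_det_mult_diag_mult)
      show "?R dvd (\<Prod>i\<in>I. \<alpha> i)" if "I \<subseteq> {..<n}" "card I = k" for I
        by (rule Gcd_dvd) (use that in blast)
    qed (use XY N in auto)
    ultimately show "?R dvd x"
      unfolding x by simp
  qed
qed (rule Gcd_int_greater_eq_0)+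

section \<open>Determinantal divisors of the Smith normal form\<close>

lemma invertible_matE:
  assumes "invertible_mat P" "P \<in> carrier_mat n n"
  obtains P' where "P' \<in> carrier_mat n n" "P * P' = 1\<^sub>m n" "P' * P = 1\<^sub>m n"
proof -
  obtain B where B: "P * B = 1\<^sub>m n" "B * P = 1\<^sub>m (dim_row B)"
    using assms by (auto simp: invertible_mat_def inverts_mat_def)
  have "dim_col B = n" "dim_row B = n"
    using arg_cong[OF B(1), of dim_col] arg_cong[OF B(2), of dim_col] assms(2) by auto
  then show ?thesis
    using B by (intro that[of B]) auto
qed

text \<open>The outer factors are absorbed: \<open>X (P A Q) Y = (X P) A (Q Y)\<close>.\<close>

lemma compressed_minors_mult_subset:
  assumes P: "P \<in> carrier_mat n n" and A: "A \<in> carrier_mat n m" and Q: "Q \<in> carrier_mat m m"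
  shows "compressed_minors k (P * A * Q) \<subseteq> compressed_minors k A"
proof
  fix x assume "x \<in> compressed_minors k (P * A * Q)"
  then obtain X Y where x: "x = det (X * (P * A * Q) * Y)"
    and X: "X \<in> carrier_mat k n" and Y: "Y \<in> carrier_mat m k"
    using assms by (auto simp: compressed_minors_def)
  have "X * (P * A * Q) * Y = (X * P) * A * (Q * Y)"
  proof -
    have "X * (P * A * Q) = X * (P * A) * Q"
      using assoc_mult_mat[OF X _ Q, of "P * A"] P A by simp
    also have "\<dots> = X * P * A * Q"
      using assoc_mult_mat[OF X P A] by simp
    finally show ?thesis
      using assoc_mult_mat[OF _ Q Y, of "X * P * A" k] X P A by simp
  qed
  then show "x \<in> compressed_minors k A"
    unfolding x compressed_minors_def using X Y P Q A
    by (intro CollectI exI[of _ "X * P"] exI[of _ "Q * Y"]) (simp add: carrier_matD)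
qed

lemma smith_normal_formE:
  assumes "is_smith_normal_form A S" "A \<in> carrier_mat n n"
  obtains P Q P' Q' where
    "P \<in> carrier_mat n n" "P' \<in> carrier_mat n n" "P * P' = 1\<^sub>m n" "P' * P = 1\<^sub>m n"
    "Q \<in> carrier_mat n n" "Q' \<in> carrier_mat n n" "Q * Q' = 1\<^sub>m n" "Q' * Q = 1\<^sub>m n"
    "S = P * A * Q" "A = P' * S * Q'"
proof -
  obtain P Q where PQ: "P \<in> carrier_mat n n" "invertible_mat P"
    "Q \<in> carrier_mat n n" "invertible_mat Q" and S: "S = P * A * Q"
    using assms by (auto simp: is_smith_normal_form_def)
  obtain P' where P': "P' \<in> carrier_mat n n" "P * P' = 1\<^sub>m n" "P' * P = 1\<^sub>m n"
    using invertible_matE[OF PQ(2,1)] .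
  obtain Q' where Q': "Q' \<in> carrier_mat n n" "Q * Q' = 1\<^sub>m n" "Q' * Q = 1\<^sub>m n"
    using invertible_matE[OF PQ(4,3)] .
  have Sn: "S \<in> carrier_mat n n"
    using S PQ assms(2) by auto
  have PA: "P * A \<in> carrier_mat n n"
    using PQ assms(2) by auto
  have "P' * S * Q' = P' * (P * A) * Q * Q'"
    using assoc_mult_mat[OF P'(1) PA PQ(3)] S by simp
  also have "\<dots> = P' * (P * A)"
    using assoc_mult_mat[of "P' * (P * A)" n n Q n Q' n] PA P' Q' PQ
      right_mult_one_mat[of "P' * (P * A)" n n] by simp
  also have "\<dots> = A"
    using assoc_mult_mat[OF P'(1) PQ(1) assms(2)] P' assms(2) by simp
  finally have A: "A = P' * S * Q'" by simp
  show ?thesis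
    by (rule that[OF PQ(1) P' PQ(3) Q' S A])
qed

lemma smith_normal_form_diagonal:
  assumes smith: "is_smith_normal_form A S" and A: "A \<in> carrier_mat n n"
  shows "S = diag_of n (\<lambda>i. S $$ (i, i))"
    and "\<And>i. Suc i < n \<Longrightarrow> S $$ (i, i) dvd S $$ (Suc i, Suc i)"
    and "\<And>i. i < n \<Longrightarrow> 0 \<le> S $$ (i, i)"
proof -
  have S: "dim_row S = n" "dim_col S = n"
    using assms by (auto simp: is_smith_normal_form_def)
  show "S = diag_of n (\<lambda>i. S $$ (i, i))"
    by (rule eq_matI) (use S smith in \<open>auto simp: is_smith_normal_form_def diagonal_mat_def diag_of_def\<close>)
  show "S $$ (i, i) dvd S $$ (Suc i, Suc i)" if "Suc i < n" for i
    using that smith S by (simp add: is_smith_normal_form_def)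
  show "0 \<le> S $$ (i, i)" if "i < n" for i
    using that smith S by (simp add: is_smith_normal_form_def)
qed

lemma smith_normal_form_compressed_minors:
  assumes "is_smith_normal_form A S" "A \<in> carrier_mat n n"
  shows "compressed_minors k S = compressed_minors k A"
proof -
  obtain P Q P' Q' where *: "P \<in> carrier_mat n n" "P' \<in> carrier_mat n n"
    "Q \<in> carrier_mat n n" "Q' \<in> carrier_mat n n" "S = P * A * Q" "A = P' * S * Q'"
    using assms by (rule smith_normal_formE)
  have S: "S \<in> carrier_mat n n"
    unfolding *(5) using *(1,3) by auto
  show ?thesis
  proof
    show "compressed_minors k S \<subseteq> compressed_minors k A"
      unfolding *(5) by (rule compressed_minors_mult_subset[OF *(1) assms(2) *(3)])
    have "compressed_minors k (P' * S * Q') \<subseteq> compressed_minors k S"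
      by (rule compressed_minors_mult_subset[OF *(2) S *(4)])
    then show "compressed_minors k A \<subseteq> compressed_minors k S"
      by (simp only: *(6)[symmetric])
  qed
qed

text \<open>The largest index of a set of \<open>k + 1\<close> naturals is at least \<open>k\<close>, so along the divisibility chain
  its entry is a multiple of entry \<open>k\<close>; the other entries are handled by induction.\<close>

lemma prod_lessThan_card_dvd_prod:
  fixes s :: "nat \<Rightarrow> 'a::comm_semiring_1"
  assumes chain: "\<And>i. Suc i < n \<Longrightarrow> s i dvd s (Suc i)"
    and I: "I \<subseteq> {..<n}"
  shows "(\<Prod>i<card I. s i) dvd (\<Prod>i\<in>I. s i)"
proof -
  have mono: "s i dvd s j" if "i \<le> j" "j < n" for i j
    using that by (induction j rule: dec_induct) (auto intro: dvd_trans chain)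
  have "finite I"
    using I by (rule finite_subset) simp
  then show ?thesis
    using I
  proof (induction "card I" arbitrary: I)
    case (Suc k)
    define m where "m = Max I"
    have m: "m \<in> I"
      using Suc by (auto simp: m_def intro!: Max_in)
    have "I \<subseteq> {..m}"
      using Suc by (auto simp: m_def)
    then have "card I \<le> Suc m"
      using card_mono[of "{..m}" I] by simp
    then have "k \<le> m" "m < n"
      using Suc m by auto
    then have "s k dvd s m"
      by (rule mono)
    moreover have "(\<Prod>i<k. s i) dvd (\<Prod>i\<in>I - {m}. s i)"
    proof -
      have k: "k = card (I - {m})"
        using Suc.hyps(2) Suc.prems m by simp
      show ?thesis
        using Suc.hyps(1)[OF k] Suc.prems unfolding k[symmetric] by blast
    qed
    ultimately have "(\<Prod>i<Suc k. s i) dvd (\<Prod>i\<in>I - {m}. s i) * s m"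
      by (simp add: mult_dvd_mono)
    then show ?case
      unfolding Suc.hyps(2)[symmetric] prod.remove[OF Suc.prems(1) m] by (simp add: mult.commute)
  qed simp
qed

text \<open>The determinants can be computed from \<open>S\<close> in place of \<open>A\<close>.  Viewing \<open>S\<close> as a diagonal matrix
  times the identity, their gcd is that of all products of \<open>k\<close> diagonal entries, and the product of the
  first \<open>k\<close> divides all the others.\<close>

lemma smith_normal_form_prod_eq_Gcd:
  assumes smith: "is_smith_normal_form A S" and A: "A \<in> carrier_mat n n" and k: "k \<le> n"
  shows "(\<Prod>i<k. S $$ (i, i)) = Gcd (compressed_minors k A)"
proof -
  let ?s = "\<lambda>i. S $$ (i, i)"
  note S = smith_normal_form_diagonal(1)[OF smith A]
    and chain = smith_normal_form_diagonal(2)[OF smith A]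
    and nonneg = smith_normal_form_diagonal(3)[OF smith A]
  have "Gcd (compressed_minors k A) = Gcd (compressed_minors k S)"
    using smith_normal_form_compressed_minors[OF smith A] by simp
  also have "\<dots> = Gcd (compressed_minors k (diag_of n ?s * 1\<^sub>m n))"
    unfolding right_mult_one_mat[OF diag_of_carrier]
    by (rule arg_cong[where f = "\<lambda>M. Gcd (compressed_minors k M)"]) (rule S)
  also have "\<dots> = Gcd {\<Prod>i\<in>I. ?s i |I. I \<subseteq> {..<n} \<and> card I = k}"
  proof (rule Gcd_compressed_minors_diag_mult)
    fix xs :: "nat list" assume xs: "distinct xs" "set xs \<subseteq> {..<n}" "length xs = k"
    \<comment> \<open>the right inverse of the selected rows of the identity places them back\<close>
    let ?Y = "mat n k (\<lambda>(l, j). if l = xs ! j then 1 else 0) :: int mat"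
    have "1\<^sub>m n * ?Y = ?Y"
      by (intro left_mult_one_mat[of _ _ k]) simp
    moreover have "xs ! i < n" if "i < k" for i
      using that xs(3) subsetD[OF xs(2) nth_mem[of i xs]] by simp
    ultimately have "\<forall>i<k. \<forall>j<k. (1\<^sub>m n * ?Y) $$ (xs ! i, j) = (if i = j then 1 else 0)"
      using xs(1,3) by (auto simp: nth_eq_iff_index_eq)
    then show "\<exists>Y \<in> carrier_mat n k. \<forall>i<k. \<forall>j<k.
        (1\<^sub>m n * Y) $$ (xs ! i, j) = (if i = j then 1 else 0 :: int)"
      by (rule bexI) simp
  qed simp
  also have "\<dots> = (\<Prod>i<k. ?s i)"
  proof (rule zdvd_antisym_nonneg)
    have "{..<k} \<subseteq> {..<n}" "card {..<k} = k"
      using k by auto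
    then show "Gcd {\<Prod>i\<in>I. ?s i |I. I \<subseteq> {..<n} \<and> card I = k} dvd (\<Prod>i<k. ?s i)"
      by (intro Gcd_dvd) blast
    show "(\<Prod>i<k. ?s i) dvd Gcd {\<Prod>i\<in>I. ?s i |I. I \<subseteq> {..<n} \<and> card I = k}"
    proof (rule Gcd_greatest)
      fix x assume "x \<in> {\<Prod>i\<in>I. ?s i |I. I \<subseteq> {..<n} \<and> card I = k}"
      then obtain I where "x = (\<Prod>i\<in>I. ?s i)" "I \<subseteq> {..<n}" "card I = k"
        by blast
      then show "(\<Prod>i<k. ?s i) dvd x"
        using prod_lessThan_card_dvd_prod[of n ?s I, OF chain] by simp
    qed
    show "0 \<le> (\<Prod>i<k. ?s i)"
      using nonneg k by (intro prod_nonneg) auto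
  qed (rule Gcd_int_greater_eq_0)
  finally show ?thesis by simp
qed

section \<open>The incidence matrix of a cycle\<close>

text \<open>Column \<open>j\<close> belongs to the edge joining \<open>j\<close> and its cyclic successor, directed towards the
  larger index.  Thus all edges follow the cycle except the last one, which leads from \<open>0\<close> to
  \<open>n - 1\<close>.\<close>

definition cycle_incidence :: "nat \<Rightarrow> int mat" where
  "cycle_incidence n = mat n n (\<lambda>(i, j).
     of_bool (i = max j (Suc j mod n)) - of_bool (i = min j (Suc j mod n)))"

lemma cycle_incidence_carrier [simp]: "cycle_incidence n \<in> carrier_mat n n"
  by (simp add: cycle_incidence_def)

text \<open>The edges \<open>0, \<dots>, a - 1\<close> form a path from \<open>0\<close> to \<open>a\<close>, so their boundaries telescope to the
  difference of its end points.\<close>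

lemma cycle_incidence_initial_segment:
  assumes "i < n" "a < n"
  shows "(\<Sum>l<n. cycle_incidence n $$ (i, l) * of_bool (l < a)) = of_bool (i = a) - of_bool (i = 0)"
proof -
  have "(\<Sum>l<n. cycle_incidence n $$ (i, l) * of_bool (l < a)) =
      (\<Sum>l<a. cycle_incidence n $$ (i, l))"
    by (rule sum.mono_neutral_cong_right) (use assms in auto)
  also have "\<dots> = (\<Sum>l<a. of_bool (i = Suc l) - of_bool (i = l))"
    by (rule sum.cong) (use assms in \<open>auto simp: cycle_incidence_def\<close>)
  also have "\<dots> = of_bool (i = a) - of_bool (i = 0)"
    by (rule sum_lessThan_telescope)
  finally show ?thesis .
qed

text \<open>As there are fewer than \<open>n\<close> selected vertices, some vertex \<open>b\<close> is left over.  Column \<open>j\<close> of \<open>Y\<close> is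
  the path from \<open>b\<close> to the \<open>j\<close>-th selected vertex, written as the difference of the paths from \<open>0\<close>.
  Its end \<open>b\<close> lies outside the selected rows, which therefore see a single unit entry.\<close>

lemma cycle_incidence_unit_columns:
  assumes xs: "distinct xs" "set xs \<subseteq> {..<n}" "length xs = k" and k: "k < n"
  shows "\<exists>Y \<in> carrier_mat n k. \<forall>i<k. \<forall>j<k.
           (cycle_incidence n * Y) $$ (xs ! i, j) = (if i = j then 1 else 0)"
proof -
  have "card (set xs) < card {..<n}"
    using k xs(3) distinct_card[OF xs(1)] by simp
  then obtain b where b: "b < n" "b \<notin> set xs"
    using card_mono[of "set xs" "{..<n}"] by (force simp: not_le[symmetric])
  define Y :: "int mat" where
    "Y = mat n k (\<lambda>(l, j). of_bool (l < xs ! j) - of_bool (l < b))"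
  have in_range: "xs ! i < n" if "i < k" for i
    using that xs(3) subsetD[OF xs(2) nth_mem[of i xs]] by simp
  have "(cycle_incidence n * Y) $$ (xs ! i, j) = (if i = j then 1 else 0)" if ij: "i < k" "j < k" for i j
  proof -
    have "(cycle_incidence n * Y) $$ (xs ! i, j) =
        (\<Sum>l<n. cycle_incidence n $$ (xs ! i, l) * (of_bool (l < xs ! j) - of_bool (l < b)))"
      using ij in_range[of i] carrier_matD[OF cycle_incidence_carrier[of n]]
      by (simp add: scalar_prod_def Y_def atLeast0LessThan)
    also have "\<dots> = of_bool (xs ! i = xs ! j) - of_bool (xs ! i = b)"
      unfolding right_diff_distrib sum_subtractf
        cycle_incidence_initial_segment[OF in_range[OF ij(1)] in_range[OF ij(2)]]
        cycle_incidence_initial_segment[OF in_range[OF ij(1)] b(1)]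
      by simp
    also have "\<dots> = (if i = j then 1 else 0)"
      using ij xs(1,3) b(2) by (auto simp: nth_eq_iff_index_eq)
    finally show ?thesis .
  qed
  then show ?thesis
    by (intro bexI[of _ Y]) (auto simp: Y_def)
qed

text \<open>The path along all edges but the last has the same boundary as the last edge, which gives a
  nonzero vector in the kernel.\<close>

lemma det_cycle_incidence:
  assumes n: "n \<ge> 2"
  shows "det (cycle_incidence n) = 0"
proof -
  define w :: "int vec" where "w = vec n (\<lambda>l. of_bool (l < n - 1) - of_bool (l = n - 1))"
  have "cycle_incidence n *\<^sub>v w = 0\<^sub>v n"
  proof (rule eq_vecI)
    fix i assume "i < dim_vec (0\<^sub>v n :: int vec)"
    then have i: "i < n" by simp
    have "(cycle_incidence n *\<^sub>v w) $ i =
        (\<Sum>l<n. cycle_incidence n $$ (i, l) * (of_bool (l < n - 1) - of_bool (l = n - 1)))"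
      using i carrier_matD[OF cycle_incidence_carrier[of n]]
      by (simp add: scalar_prod_def w_def atLeast0LessThan)
    also have "\<dots> = of_bool (i = n - 1) - of_bool (i = 0) - cycle_incidence n $$ (i, n - 1)"
      using i n cycle_incidence_initial_segment[of i n "n - 1"]
      by (simp add: right_diff_distrib sum_subtractf)
    also have "\<dots> = 0"
      using i n by (simp add: cycle_incidence_def)
    finally show "(cycle_incidence n *\<^sub>v w) $ i = 0\<^sub>v n $ i"
      using i by simp
  qed (simp add: cycle_incidence_def)
  moreover have "w \<noteq> 0\<^sub>v n"
  proof
    assume "w = 0\<^sub>v n"
    then have "w $ 0 = 0" using n by simp
    then show False using n by (simp add: w_def)
  qed
  moreover have "w \<in> carrier_vec n"
    by (simp add: w_def)
  ultimately show ?thesis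
    using det_0_iff_vec_prod_zero[OF cycle_incidence_carrier] by blast
qed

section \<open>The boundary matrix of a polygon\<close>

lemma ngon_edge:
  fixes v :: "nat \<Rightarrow> 'a::linorder"
  assumes n: "n \<ge> 2" and v: "strict_mono_on {..<n} v" and j: "j < n"
  defines "a \<equiv> min j (Suc j mod n)" and "b \<equiv> max j (Suc j mod n)"
  shows "a < b" "b < n" "{v j, v (Suc j mod n)} = {v a, v b}" "v a < v b"
    "Min {v j, v (Suc j mod n)} = v a" "Max {v j, v (Suc j mod n)} = v b"
    "card {v j, v (Suc j mod n)} = 2"
proof -
  have "Suc j mod n < n" "Suc j mod n \<noteq> j"
    using n j by (auto simp: mod_Suc)
  then show ab: "a < b" "b < n" and e: "{v j, v (Suc j mod n)} = {v a, v b}"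
    using j by (auto simp: a_def b_def min_def max_def)
  show less: "v a < v b"
    using v ab by (auto simp: strict_mono_on_def)
  show "Min {v j, v (Suc j mod n)} = v a" "Max {v j, v (Suc j mod n)} = v b"
    "card {v j, v (Suc j mod n)} = 2"
    unfolding e using less by auto
qed

text \<open>An edge puts the weight \<open>\<alpha> i\<close>, up to the sign prescribed by its direction, at each of its end
  points \<open>i\<close>; the weight depends on the row only.\<close>

lemma ngon_boundary_matrix_eq:
  fixes v :: "nat \<Rightarrow> 'a::linorder"
  assumes n: "n \<ge> 2" and v: "strict_mono_on {..<n} v"
    and \<phi>: "\<And>i j. i < j \<Longrightarrow> j < n \<Longrightarrow> {v i, v j} \<in> simplices (ngon n v) 1 \<Longrightarrow>
           \<phi> {v i, v j} {v i} = \<alpha> i \<and> \<phi> {v i, v j} {v j} = \<alpha> j"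
  shows "ngon_boundary_matrix n v \<phi> = diag_of n \<alpha> * cycle_incidence n"
proof (rule eq_matI)
  fix i j assume "i < dim_row (diag_of n \<alpha> * cycle_incidence n)"
    "j < dim_col (diag_of n \<alpha> * cycle_incidence n)"
  then have ij: "i < n" "j < n"
    by (simp_all add: cycle_incidence_def)
  define a b where "a = min j (Suc j mod n)" and "b = max j (Suc j mod n)"
  note e = ngon_edge[OF n v ij(2), folded a_def b_def]
  have "{v j, v (Suc j mod n)} \<in> simplices (ngon n v) 1"
    using e(7) ij by (auto simp: simplices_def ngon_def)
  then have weights: "\<phi> {v a, v b} {v a} = \<alpha> a" "\<phi> {v a, v b} {v b} = \<alpha> b"
    using \<phi>[OF e(1,2)] unfolding e(3) by auto
  have inj: "v i = v l \<longleftrightarrow> i = l" if "l < n" for l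
    using strict_mono_on_imp_inj_on[OF v] ij that by (auto simp: inj_on_def)
  have "ngon_boundary_matrix n v \<phi> $$ (i, j) =
      \<alpha> b * of_bool (i = b) - \<alpha> a * of_bool (i = a)"
    using ij e weights inj[of a] inj[of b]
    by (auto simp: ngon_boundary_matrix_def matrix_wrt_def weighted_boundary1_def lookup_minus)
  also have "\<dots> = (diag_of n \<alpha> * cycle_incidence n) $$ (i, j)"
    using ij index_diag_of_mult[OF cycle_incidence_carrier ij, of \<alpha>]
    by (auto simp: cycle_incidence_def a_def b_def)
  finally show "ngon_boundary_matrix n v \<phi> $$ (i, j) = (diag_of n \<alpha> * cycle_incidence n) $$ (i, j)" .
qed (simp_all add: ngon_boundary_matrix_def matrix_wrt_def cycle_incidence_def)

section \<open>Cokernels of homomorphisms between free abelian groups\<close>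

definition coords :: "'a list \<Rightarrow> ('a \<Rightarrow>\<^sub>0 int) \<Rightarrow> int vec" where
  "coords xs c = vec (length xs) (\<lambda>i. Poly_Mapping.lookup c (xs ! i))"

lemma coords_carrier [simp]: "coords xs c \<in> carrier_vec (length xs)"
  by (simp add: coords_def)

lemma coords_add: "coords xs (a + b) = coords xs a + coords xs b"
  by (rule eq_vecI) (auto simp: coords_def lookup_add)

lemma coords_inject:
  assumes "Poly_Mapping.keys a \<subseteq> set xs" "Poly_Mapping.keys b \<subseteq> set xs"
    and eq: "coords xs a = coords xs b"
  shows "a = b"
proof (rule poly_mapping_eqI)
  fix x
  show "Poly_Mapping.lookup a x = Poly_Mapping.lookup b x"
  proof (cases "x \<in> set xs")
    case True
    then obtain i where i: "i < length xs" "xs ! i = x"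
      by (auto simp: in_set_conv_nth)
    show ?thesis
      using arg_cong[OF eq, of "\<lambda>u. u $ i"] i by (simp add: coords_def)
  next
    case False
    then have "x \<notin> Poly_Mapping.keys a" "x \<notin> Poly_Mapping.keys b"
      using assms by auto
    then show ?thesis
      by (simp add: in_keys_iff)
  qed
qed

lemma coords_surj:
  assumes xs: "distinct xs" and w: "w \<in> carrier_vec (length xs)"
  obtains c where "Poly_Mapping.keys c \<subseteq> set xs" "coords xs c = w"
proof
  define c where "c = (\<Sum>j<length xs. frag_cmul (w $ j) (frag_of (xs ! j)))"
  show "Poly_Mapping.keys c \<subseteq> set xs"
    unfolding c_def
    by (rule order_trans[OF keys_sum]) (auto simp: keys_frag_of)
  have "Poly_Mapping.lookup c (xs ! i) = w $ i" if i: "i < length xs" for i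
  proof -
    have "Poly_Mapping.lookup c (xs ! i) = (\<Sum>j<length xs. w $ j * of_bool (j = i))"
      unfolding c_def lookup_sum
      by (rule sum.cong) (use i xs in \<open>auto simp: nth_eq_iff_index_eq\<close>)
    then show ?thesis
      using i by simp
  qed
  then show "coords xs c = w"
    using w by (auto simp: coords_def intro!: eq_vecI)
qed

lemma lookup_frag_extend:
  assumes "finite A" "Poly_Mapping.keys c \<subseteq> A"
  shows "Poly_Mapping.lookup (frag_extend g c) y =
           (\<Sum>x\<in>A. Poly_Mapping.lookup c x * Poly_Mapping.lookup (g x) y)"
  unfolding frag_extend_def lookup_sum
  by (rule sum.mono_neutral_cong_left) (use assms in \<open>auto simp: in_keys_iff\<close>)

lemma coords_frag_extend:
  assumes xs: "distinct xs" and c: "Poly_Mapping.keys c \<subseteq> set xs"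
  shows "coords ys (frag_extend g c) = matrix_wrt (frag_extend g) xs ys *\<^sub>v coords xs c"
proof (rule eq_vecI)
  fix i assume "i < dim_vec (matrix_wrt (frag_extend g) xs ys *\<^sub>v coords xs c)"
  then have i: "i < length ys"
    by (simp add: matrix_wrt_def)
  have "coords ys (frag_extend g c) $ i =
      (\<Sum>x\<in>set xs. Poly_Mapping.lookup c x * Poly_Mapping.lookup (g x) (ys ! i))"
    using i c by (simp add: coords_def lookup_frag_extend[of "set xs"])
  also have "\<dots> = (\<Sum>j<length xs. Poly_Mapping.lookup c (xs ! j) * Poly_Mapping.lookup (g (xs ! j)) (ys ! i))"
    by (rule sum.reindex_bij_betw[symmetric]) (rule bij_betw_nth[OF xs refl refl])
  also have "\<dots> = (matrix_wrt (frag_extend g) xs ys *\<^sub>v coords xs c) $ i"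
    using i by (simp add: matrix_wrt_def coords_def scalar_prod_def atLeast0LessThan mult.commute)
  finally show "coords ys (frag_extend g c) $ i = (matrix_wrt (frag_extend g) xs ys *\<^sub>v coords xs c) $ i" .
qed (simp add: coords_def matrix_wrt_def)

text \<open>Since \<open>P A Q = S\<close> and \<open>Q\<close> is bijective, \<open>P\<close> maps the range of \<open>A\<close> onto the range of the diagonal
  matrix \<open>S\<close>.\<close>

lemma mem_range_smith_iff:
  assumes smith: "is_smith_normal_form A S" "A \<in> carrier_mat n n"
  obtains P where "P \<in> carrier_mat n n" "invertible_mat P"
    "\<And>u. u \<in> carrier_vec n \<Longrightarrow>
       (\<exists>z \<in> carrier_vec n. u = A *\<^sub>v z) \<longleftrightarrow> (\<forall>i<n. S $$ (i, i) dvd (P *\<^sub>v u) $ i)"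
proof -
  obtain P Q P' Q' where P: "P \<in> carrier_mat n n" "P' \<in> carrier_mat n n" "P * P' = 1\<^sub>m n" "P' * P = 1\<^sub>m n"
    and Q: "Q \<in> carrier_mat n n" "Q' \<in> carrier_mat n n" "Q * Q' = 1\<^sub>m n" "Q' * Q = 1\<^sub>m n"
    and S: "S = P * A * Q"
    using smith by (rule smith_normal_formE)
  have Sn: "S \<in> carrier_mat n n"
    unfolding S using P(1) Q(1) by auto
  have S_apply: "S *\<^sub>v y = P *\<^sub>v (A *\<^sub>v (Q *\<^sub>v y))" if y: "y \<in> carrier_vec n" for y
    unfolding S using assoc_mult_mat_vec[OF mult_carrier_mat[OF P(1) smith(2)] Q(1) y]
      assoc_mult_mat_vec[OF P(1) smith(2) mult_mat_vec_carrier[OF Q(1) y]] by simp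
  have cancel: "M *\<^sub>v (M' *\<^sub>v y) = y"
    if "M \<in> carrier_mat n n" "M' \<in> carrier_mat n n" "M * M' = 1\<^sub>m n" "y \<in> carrier_vec n"
    for M M' :: "int mat" and y
    using assoc_mult_mat_vec[OF that(1,2,4)] that(3,4) by simp
  have S_vec: "(S *\<^sub>v z) $ i = S $$ (i, i) * z $ i" if "z \<in> carrier_vec n" "i < n" for z i
  proof -
    have "(S *\<^sub>v z) $ i = (\<Sum>l<n. S $$ (i, l) * z $ l)"
      using that Sn by (simp add: scalar_prod_def atLeast0LessThan)
    also have "\<dots> = (\<Sum>l<n. if l = i then S $$ (i, i) * z $ i else 0)"
      by (rule sum.cong)
        (use that smith Sn in \<open>auto simp: is_smith_normal_form_def diagonal_mat_def\<close>)
    finally show ?thesis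
      using that by simp
  qed
  show ?thesis
  proof (rule that[OF P(1)])
    show "invertible_mat P"
      using P by (auto simp: invertible_mat_def inverts_mat_def)
    fix u :: "int vec" assume u: "u \<in> carrier_vec n"
    show "(\<exists>z \<in> carrier_vec n. u = A *\<^sub>v z) \<longleftrightarrow> (\<forall>i<n. S $$ (i, i) dvd (P *\<^sub>v u) $ i)"
    proof
      assume "\<exists>z \<in> carrier_vec n. u = A *\<^sub>v z"
      then obtain z where z: "z \<in> carrier_vec n" "u = A *\<^sub>v z" by blast
      have "P *\<^sub>v u = S *\<^sub>v (Q' *\<^sub>v z)"
        using S_apply[of "Q' *\<^sub>v z"] cancel[OF Q(1-3) z(1)] Q(2) z by simp
      then show "\<forall>i<n. S $$ (i, i) dvd (P *\<^sub>v u) $ i"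
        using S_vec[OF mult_mat_vec_carrier[OF Q(2) z(1)]] by simp
    next
      assume dvd: "\<forall>i<n. S $$ (i, i) dvd (P *\<^sub>v u) $ i"
      \<comment> \<open>if a diagonal entry is 0, so is the coordinate that it divides, and the quotient 0 is right\<close>
      define z where "z = vec n (\<lambda>i. (P *\<^sub>v u) $ i div S $$ (i, i))"
      have z: "z \<in> carrier_vec n"
        by (simp add: z_def)
      have Pu: "P *\<^sub>v u = S *\<^sub>v z"
      proof (rule eq_vecI)
        show "(P *\<^sub>v u) $ i = (S *\<^sub>v z) $ i" if "i < dim_vec (S *\<^sub>v z)" for i
          using that Sn dvd S_vec[OF z] by (simp add: z_def)
      qed (use P Sn in simp)
      have "u = P' *\<^sub>v (P *\<^sub>v u)"
        using cancel[OF P(2,1,4) u] by simp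
      also have "\<dots> = A *\<^sub>v (Q *\<^sub>v z)"
        unfolding Pu S_apply[OF z] by (rule cancel[OF P(2,1,4)]) (use smith(2) Q(1) z in auto)
      finally show "\<exists>z \<in> carrier_vec n. u = A *\<^sub>v z"
        using Q(1) z by auto
    qed
  qed
qed

text \<open>The homomorphism theorem is applied to the map that sends a chain with coordinate vector \<open>u\<close> to
  the coordinates of \<open>P u\<close> reduced modulo \<open>d 1, \<dots>, d n\<close>.  A modulus \<open>0\<close> leaves the integer
  unchanged, in agreement with the meaning of the integers modulo \<open>0\<close>.\<close>

lemma free_Abelian_group_Mod_image_iso:
  fixes g :: "'a \<Rightarrow> 'b \<Rightarrow>\<^sub>0 int"
  assumes xs: "distinct xs" "length xs = n" and ys: "distinct ys" "length ys = n"
    and g: "\<And>x. x \<in> set xs \<Longrightarrow> Poly_Mapping.keys (g x) \<subseteq> set ys"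
    and smith: "is_smith_normal_form (matrix_wrt (frag_extend g) xs ys) S"
    and d: "\<And>k. k \<in> {1..n} \<Longrightarrow> int (d k) = S $$ (k - 1, k - 1)"
  shows "free_Abelian_group (set ys) Mod (frag_extend g ` carrier (free_Abelian_group (set xs)))
           \<cong> sum_group {1..n} (\<lambda>k. integer_mod_group (d k))"
proof -
  let ?A = "matrix_wrt (frag_extend g) xs ys"
  let ?G = "free_Abelian_group (set ys)"
  let ?H = "sum_group {1..n} (\<lambda>k. integer_mod_group (d k))"
  have A: "?A \<in> carrier_mat n n"
    using xs ys by (simp add: matrix_wrt_def)
  obtain P where P: "P \<in> carrier_mat n n" "invertible_mat P"
    and range: "\<And>u. u \<in> carrier_vec n \<Longrightarrow>
      (\<exists>z \<in> carrier_vec n. u = ?A *\<^sub>v z) \<longleftrightarrow> (\<forall>i<n. S $$ (i, i) dvd (P *\<^sub>v u) $ i)"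
    using mem_range_smith_iff[OF smith A] by blast
  have coords_ys: "coords ys c \<in> carrier_vec n" for c
    using coords_carrier[of ys c] ys(2) by simp
  define h where "h c = (\<lambda>k\<in>{1..n}. (P *\<^sub>v coords ys c) $ (k - 1) mod int (d k))" for c
  have carrier_H: "carrier ?H = (\<Pi>\<^sub>E k\<in>{1..n}. carrier (integer_mod_group (d k)))"
    by (subst carrier_sum_group) auto
  have mod_mem: "a mod int m \<in> carrier (integer_mod_group m)" for a m
    by (auto simp: carrier_integer_mod_group)
  interpret h: group_hom ?G ?H h
  proof (intro group_hom.intro group_hom_axioms.intro homI)
    show "h c \<in> carrier ?H" for c
      unfolding carrier_H h_def by (auto intro!: mod_mem)
    fix a b
    have "(P *\<^sub>v coords ys (a + b)) $ (k - 1) =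
        (P *\<^sub>v coords ys a) $ (k - 1) + (P *\<^sub>v coords ys b) $ (k - 1)" if "k \<in> {1..n}" for k
    proof -
      have "P *\<^sub>v coords ys (a + b) = P *\<^sub>v coords ys a + P *\<^sub>v coords ys b"
        unfolding coords_add by (rule mult_add_distrib_mat_vec[OF P(1) coords_ys coords_ys])
      then show ?thesis
        using that P(1) by (auto simp del: index_mult_mat_vec)
    qed
    then show "h (a \<otimes>\<^bsub>?G\<^esub> b) = h a \<otimes>\<^bsub>?H\<^esub> h b"
      by (auto simp: h_def mod_add_eq intro!: restrict_ext)
  qed auto
  have "h ` carrier ?G = carrier ?H"
  proof
    show "carrier ?H \<subseteq> h ` carrier ?G"
    proof
      fix y assume y: "y \<in> carrier ?H"
      obtain P' where P': "P' \<in> carrier_mat n n" "P * P' = 1\<^sub>m n"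
        using invertible_matE[OF P(2,1)] by blast
      define w where "w = vec n (\<lambda>i. y (Suc i))"
      have w: "w \<in> carrier_vec n"
        by (simp add: w_def)
      obtain c where c: "Poly_Mapping.keys c \<subseteq> set ys" "coords ys c = P' *\<^sub>v w"
        by (rule coords_surj[OF ys(1), of "P' *\<^sub>v w"])
          (use mult_mat_vec_carrier[OF P'(1) w] ys(2) in auto)
      have Pc: "P *\<^sub>v coords ys c = w"
        using P P' w by (simp add: c(2) assoc_mult_mat_vec[of P n n P' n, symmetric])
      have "h c = y"
      proof
        fix k
        show "h c k = y k"
        proof (cases "k \<in> {1..n}")
          case True
          then have "y k \<in> carrier (integer_mod_group (d k))"
            using y unfolding carrier_H by auto
          then have "y k mod int (d k) = y k"
            by (auto simp: carrier_integer_mod_group split: if_splits)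
          moreover have "k - 1 < n" "Suc (k - 1) = k"
            using True by auto
          ultimately show ?thesis
            using True by (simp add: h_def Pc w_def del: One_nat_def)
        next
          case False
          then show ?thesis
            using y unfolding carrier_H h_def by (auto simp: PiE_def extensional_def)
        qed
      qed
      then show "y \<in> h ` carrier ?G"
        using c(1) by auto
    qed
  qed (use h.hom_closed in auto)
  moreover have "kernel ?G ?H h = frag_extend g ` carrier (free_Abelian_group (set xs))"
  proof -
    have image: "Poly_Mapping.keys (frag_extend g e) \<subseteq> set ys" if "Poly_Mapping.keys e \<subseteq> set xs" for e
      using keys_frag_extend[of g e] g that by blast
    have "h c = \<one>\<^bsub>?H\<^esub> \<longleftrightarrow> (\<exists>z \<in> carrier_vec n. coords ys c = ?A *\<^sub>v z)" for c
    proof -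
      have "h c = \<one>\<^bsub>?H\<^esub> \<longleftrightarrow> (\<forall>k\<in>{1..n}. (P *\<^sub>v coords ys c) $ (k - 1) mod int (d k) = 0)"
        by (auto simp: h_def fun_eq_iff)
      also have "\<dots> \<longleftrightarrow> (\<forall>k\<in>{1..n}. S $$ (k - 1, k - 1) dvd (P *\<^sub>v coords ys c) $ (k - 1))"
        by (intro ball_cong refl) (simp add: d dvd_eq_mod_eq_0)
      also have "\<dots> \<longleftrightarrow> (\<forall>i<n. S $$ (i, i) dvd (P *\<^sub>v coords ys c) $ i)"
        unfolding image_Suc_lessThan[symmetric] by auto
      finally show ?thesis
        by (simp only: range[OF coords_ys])
    qed
    moreover have "(\<exists>z \<in> carrier_vec n. coords ys c = ?A *\<^sub>v z) \<longleftrightarrow>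
        c \<in> frag_extend g ` {e. Poly_Mapping.keys e \<subseteq> set xs}"
      if c: "Poly_Mapping.keys c \<subseteq> set ys" for c
    proof
      assume "\<exists>z \<in> carrier_vec n. coords ys c = ?A *\<^sub>v z"
      then obtain z where z: "z \<in> carrier_vec n" "coords ys c = ?A *\<^sub>v z" by blast
      obtain e where e: "Poly_Mapping.keys e \<subseteq> set xs" "coords xs e = z"
        by (rule coords_surj[OF xs(1), of z]) (use z xs in auto)
      have "c = frag_extend g e"
        by (rule coords_inject[OF c image[OF e(1)]]) (simp add: coords_frag_extend[OF xs(1) e(1)] e(2) z(2))
      then show "c \<in> frag_extend g ` {e. Poly_Mapping.keys e \<subseteq> set xs}"
        using e by blast
    next
      assume "c \<in> frag_extend g ` {e. Poly_Mapping.keys e \<subseteq> set xs}"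
      then obtain e where e: "Poly_Mapping.keys e \<subseteq> set xs" "c = frag_extend g e" by blast
      then show "\<exists>z \<in> carrier_vec n. coords ys c = ?A *\<^sub>v z"
        using coords_carrier[of xs e] xs by (auto simp: coords_frag_extend intro!: bexI[of _ "coords xs e"])
    qed
    ultimately have "kernel ?G ?H h = {c \<in> carrier ?G. c \<in> frag_extend g ` {e. Poly_Mapping.keys e \<subseteq> set xs}}"
      unfolding kernel_def by (intro Collect_cong conj_cong refl) simp
    also have "\<dots> = frag_extend g ` carrier (free_Abelian_group (set xs))"
      using image by (auto simp: free_Abelian_group_def)
    finally show ?thesis .
  qed
  ultimately show ?thesis
    using h.FactGroup_iso by simp
qed

lemma sum_group_insert_iso:
  assumes i: "i \<notin> I" and G: "\<And>j. j \<in> insert i I \<Longrightarrow> group (G j)"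
  shows "sum_group (insert i I) G \<cong> sum_group I G \<times>\<times> G i"
proof (rule is_isoI)
  let ?f = "\<lambda>x. (restrict x I, x i)"
  have carrier_insert: "carrier (sum_group (insert i I) G) =
      {x \<in> \<Pi>\<^sub>E j\<in>insert i I. carrier (G j). finite {j \<in> I. x j \<noteq> \<one>\<^bsub>G j\<^esub>}}"
  proof -
    have fin: "finite {j \<in> insert i I. x j \<noteq> \<one>\<^bsub>G j\<^esub>} \<longleftrightarrow> finite {j \<in> I. x j \<noteq> \<one>\<^bsub>G j\<^esub>}" for x
    proof
      assume "finite {j \<in> I. x j \<noteq> \<one>\<^bsub>G j\<^esub>}"
      then have "finite (insert i {j \<in> I. x j \<noteq> \<one>\<^bsub>G j\<^esub>})" by simp
      then show "finite {j \<in> insert i I. x j \<noteq> \<one>\<^bsub>G j\<^esub>}"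
        by (rule rev_finite_subset) auto
    qed (auto elim: rev_finite_subset)
    show ?thesis
      using carrier_sum_group[of "insert i I" G, OF G] by (simp only: fin)
  qed
  have carrier_I: "carrier (sum_group I G) =
      {x \<in> \<Pi>\<^sub>E j\<in>I. carrier (G j). finite {j \<in> I. x j \<noteq> \<one>\<^bsub>G j\<^esub>}}"
    by (rule carrier_sum_group) (simp add: G)
  show "?f \<in> iso (sum_group (insert i I) G) (sum_group I G \<times>\<times> G i)"
    unfolding iso_def
  proof (intro CollectI conjI)
    show "?f \<in> hom (sum_group (insert i I) G) (sum_group I G \<times>\<times> G i)"
      by (rule homI) (auto simp: carrier_insert carrier_I PiE_iff conj_commute intro!: restrict_ext cong: rev_conj_cong)
    show "bij_betw ?f (carrier (sum_group (insert i I) G)) (carrier (sum_group I G \<times>\<times> G i))"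
    proof (rule bij_betw_byWitness[where f' = "\<lambda>(x, y). x(i := y)"])
      show "\<forall>x\<in>carrier (sum_group (insert i I) G). (\<lambda>(x, y). x(i := y)) (?f x) = x"
        by (auto simp: carrier_insert PiE_iff extensional_def fun_eq_iff)
      show "\<forall>p\<in>carrier (sum_group I G \<times>\<times> G i). ?f ((\<lambda>(x, y). x(i := y)) p) = p"
        using i by (auto simp: carrier_I PiE_iff extensional_def fun_eq_iff)
      show "?f ` carrier (sum_group (insert i I) G) \<subseteq> carrier (sum_group I G \<times>\<times> G i)"
        by (auto simp: carrier_insert carrier_I conj_commute cong: rev_conj_cong)
      have "{j \<in> I. (x(i := y)) j \<noteq> \<one>\<^bsub>G j\<^esub>} = {j \<in> I. x j \<noteq> \<one>\<^bsub>G j\<^esub>}" for x y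
        using i by auto
      then show "(\<lambda>(x, y). x(i := y)) ` carrier (sum_group I G \<times>\<times> G i) \<subseteq> carrier (sum_group (insert i I) G)"
        by (auto simp: carrier_insert carrier_I PiE_iff extensional_def)
    qed
  qed
qed

section \<open>The weighted homology of a polygon\<close>

lemma simplices_ngon:
  fixes v :: "nat \<Rightarrow> 'a::linorder"
  assumes n: "n \<ge> 2" and v: "strict_mono_on {..<n} v"
  shows "simplices (ngon n v) 0 = set (map (\<lambda>i. {v i}) [0..<n])"
    and "simplices (ngon n v) 1 = set (map (\<lambda>i. {v i, v (Suc i mod n)}) [0..<n])"
proof -
  let ?V = "(\<lambda>i. {v i}) ` {..<n}" and ?E = "(\<lambda>i. {v i, v (Suc i mod n)}) ` {..<n}"
  have "ngon n v = ?V \<union> ?E"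
    unfolding ngon_def by blast
  moreover have "\<forall>\<sigma>\<in>?V. card \<sigma> = 1"
    by simp
  moreover have "\<forall>\<sigma>\<in>?E. card \<sigma> = 2"
    using ngon_edge(7)[OF n v] by blast
  ultimately have "simplices (ngon n v) 0 = ?V" "simplices (ngon n v) 1 = ?E"
    unfolding simplices_def by fastforce+
  then show "simplices (ngon n v) 0 = set (map (\<lambda>i. {v i}) [0..<n])"
    and "simplices (ngon n v) 1 = set (map (\<lambda>i. {v i, v (Suc i mod n)}) [0..<n])"
    by (simp_all only: set_map set_upt atLeast0LessThan)
qed

text \<open>For two vertices the two edges would coincide; this is where at least three are required.\<close>

lemma distinct_ngon_simplices:
  fixes v :: "nat \<Rightarrow> 'a::linorder"
  assumes n: "n \<ge> 3" and v: "strict_mono_on {..<n} v"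
  shows "distinct (map (\<lambda>i. {v i}) [0..<n])"
    and "distinct (map (\<lambda>i. {v i, v (Suc i mod n)}) [0..<n])"
proof -
  have inj: "inj_on v {..<n}"
    using v by (rule strict_mono_on_imp_inj_on)
  show "distinct (map (\<lambda>i. {v i}) [0..<n])"
    using inj by (auto simp: distinct_map inj_on_def)
  have "i = j" if ij: "i < n" "j < n" and eq: "{v i, v (Suc i mod n)} = {v j, v (Suc j mod n)}" for i j
  proof -
    have "v ` {i, Suc i mod n} = v ` {j, Suc j mod n}"
      using eq by simp
    then have "{i, Suc i mod n} = {j, Suc j mod n}"
      by (subst (asm) inj_on_image_eq_iff[OF inj]) (use ij in auto)
    then show ?thesis
      using ij n by (auto simp: doubleton_eq_iff mod_Suc split: if_splits)
  qed
  then show "distinct (map (\<lambda>i. {v i, v (Suc i mod n)}) [0..<n])"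
    by (auto simp: distinct_map inj_on_def)
qed

theorem theorem7p3:
  fixes n :: nat and v :: "nat \<Rightarrow> 'a::linorder" and \<alpha> :: "nat \<Rightarrow> int"
    and \<phi> :: "'a set \<Rightarrow> 'a set \<Rightarrow> int" and S :: "int mat" and d :: "nat \<Rightarrow> nat"
  assumes "n \<ge> 3"
    and "strict_mono_on {..<n} v"
    and "\<And>i j. i < j \<Longrightarrow> j < n \<Longrightarrow> {v i, v j} \<in> simplices (ngon n v) 1 \<Longrightarrow>
           \<phi> {v i, v j} {v i} = \<alpha> i \<and> \<phi> {v i, v j} {v j} = \<alpha> j"
    and "is_smith_normal_form (ngon_boundary_matrix n v \<phi>) S"
    and "\<And>k. k \<in> {1..n} \<Longrightarrow> int (d k) = S $$ (k - 1, k - 1)"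
  shows "weighted_H0 (ngon n v) \<phi> \<cong>
           sum_group {1..n - 1} (\<lambda>k. integer_mod_group (d k)) \<times>\<times> integer_group \<and>
         (\<forall>k \<in> {1..n - 1}. (\<Prod>j = 1..k. int (d j)) =
           Gcd {\<Prod>i\<in>I. \<alpha> i |I. I \<subseteq> {..<n} \<and> card I = k}) \<and>
         d n = 0"
proof -
  let ?A = "diag_of n \<alpha> * cycle_incidence n"
  let ?xs = "map (\<lambda>i. {v i, v (Suc i mod n)}) [0..<n]" and ?ys = "map (\<lambda>i. {v i}) [0..<n]"
  note n = assms(1) and v = assms(2) and smith = assms(4) and d = assms(5)
  have n2: "n \<ge> 2" using n by simp
  have A_eq: "ngon_boundary_matrix n v \<phi> = ?A"
    using n2 v assms(3) by (rule ngon_boundary_matrix_eq)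
  have A: "?A \<in> carrier_mat n n"
    by (rule mult_carrier_mat[OF diag_of_carrier cycle_incidence_carrier])
  have smith_A: "is_smith_normal_form ?A S"
    using smith by (simp only: A_eq)

  have Gcds: "(\<Prod>j = 1..k. int (d j)) = Gcd {\<Prod>i\<in>I. \<alpha> i |I. I \<subseteq> {..<n} \<and> card I = k}"
    if k: "k \<in> {1..n - 1}" for k
  proof -
    have "(\<Prod>j = 1..k. int (d j)) = (\<Prod>i<k. int (d (Suc i)))"
      unfolding image_Suc_lessThan[symmetric] by (simp add: prod.reindex)
    also have "\<dots> = (\<Prod>i<k. S $$ (i, i))"
      by (rule prod.cong) (use k d in auto)
    also have "\<dots> = Gcd (compressed_minors k ?A)"
      by (rule smith_normal_form_prod_eq_Gcd[OF smith_A A]) (use k in auto)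
    also have "\<dots> = Gcd {\<Prod>i\<in>I. \<alpha> i |I. I \<subseteq> {..<n} \<and> card I = k}"
      by (rule Gcd_compressed_minors_diag_mult[OF cycle_incidence_carrier])
        (rule cycle_incidence_unit_columns, use k n in auto)
    finally show ?thesis .
  qed

  have dn: "d n = 0"
  proof -
    obtain P Q where PQ: "P \<in> carrier_mat n n" "Q \<in> carrier_mat n n" "S = P * ?A * Q"
      by (rule smith_normal_formE[OF smith_A A])
    have "det ?A = 0"
      using det_mult[OF diag_of_carrier cycle_incidence_carrier, of n \<alpha>] det_cycle_incidence[OF n2] by simp
    then have "det S = 0"
      using PQ A by (simp add: det_mult[of _ n])
    moreover have "det S = (\<Prod>i<n. S $$ (i, i))"
      by (subst smith_normal_form_diagonal(1)[OF smith_A A]) (rule det_diag_of)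
    ultimately obtain i where i: "i < n" "S $$ (i, i) = 0"
      by auto
    \<comment> \<open>a zero entry propagates along the divisibility chain to the last position\<close>
    have "S $$ (i, i) dvd S $$ (j, j)" if "i \<le> j" "j < n" for j
      using that by (induction j rule: dec_induct)
        (auto intro: dvd_trans smith_normal_form_diagonal(2)[OF smith_A A])
    from this[of "n - 1"] i have "S $$ (n - 1, n - 1) = 0"
      by simp
    then show ?thesis
      using d[of n] n by simp
  qed

  have "weighted_H0 (ngon n v) \<phi> \<cong> sum_group {1..n} (\<lambda>k. integer_mod_group (d k))"
    unfolding weighted_H0_def chain_grp_def simplices_ngon[OF n2 v] weighted_boundary1_def
  proof (rule free_Abelian_group_Mod_image_iso)
    show "distinct ?xs" "distinct ?ys"
      by (rule distinct_ngon_simplices[OF n v])+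
    show "is_smith_normal_form (matrix_wrt (frag_extend (\<lambda>\<sigma>.
        frag_cmul (\<phi> \<sigma> {Max \<sigma>}) (frag_of {Max \<sigma>}) -
        frag_cmul (\<phi> \<sigma> {Min \<sigma>}) (frag_of {Min \<sigma>}))) ?xs ?ys) S"
      using smith by (simp only: ngon_boundary_matrix_def weighted_boundary1_def)
    fix \<sigma> assume "\<sigma> \<in> set ?xs"
    then obtain j where j: "j < n" "\<sigma> = {v j, v (Suc j mod n)}"
      by auto
    have "Max \<sigma> \<in> v ` {..<n}" "Min \<sigma> \<in> v ` {..<n}"
      using ngon_edge[OF n2 v j(1)] unfolding j(2) by auto
    then show "Poly_Mapping.keys (frag_cmul (\<phi> \<sigma> {Max \<sigma>}) (frag_of {Max \<sigma>}) -
        frag_cmul (\<phi> \<sigma> {Min \<sigma>}) (frag_of {Min \<sigma>})) \<subseteq> set ?ys"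
      by (intro order_trans[OF keys_diff]) (auto simp: keys_frag_of)
  qed (use d in auto)
  moreover have "sum_group {1..n} (\<lambda>k. integer_mod_group (d k)) \<cong>
      sum_group {1..n - 1} (\<lambda>k. integer_mod_group (d k)) \<times>\<times> integer_group"
  proof -
    have "{1..n} = insert n {1..n - 1}"
      using n by auto
    moreover have "integer_group = integer_mod_group (d n)"
      by (simp add: dn integer_mod_group_def)
    moreover have "sum_group (insert n {1..n - 1}) (\<lambda>k. integer_mod_group (d k)) \<cong>
        sum_group {1..n - 1} (\<lambda>k. integer_mod_group (d k)) \<times>\<times> integer_mod_group (d n)"
      by (rule sum_group_insert_iso) (use n in auto)
    ultimately show ?thesis
      by (simp only:)
  qed
  ultimately have "weighted_H0 (ngon n v) \<phi> \<cong>
      sum_group {1..n - 1} (\<lambda>k. integer_mod_group (d k)) \<times>\<times> integer_group"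
    by (rule iso_trans)
  then show ?thesis
    using Gcds dn by (intro conjI ballI)
qed

end
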